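(* The Riemannian metric $\Gamma$ on $S_{\mathrm{reg}}$ is flat.
   Context: Let $a=2\cos\frac{2\pi}{5}$, $b=2\cos\frac{\pi}{5}$ (so $0<a<b$), and $f(\xi)=\xi^{8}(\xi-a)^{3}(\xi-b)^{9}$. Let $S=\{(\xi,\eta)\in\mathbb{C}^2 : \eta^{10}=f(\xi)\}$ and $S_{\mathrm{reg}}=S\setminus\{(0,0),(a,0),(b,0)\}$, a smooth connected $1$-dimensional complex submanifold of $\mathbb{C}^2\setminus\{\eta=0\}$. Let $k>0$ be the constant $k=a\big/\int_0^a x^{-4/5}(a-x)^{-3/10}(b-x)^{-9/10}\,dx$ (the normalizing constant of the Schwarz-Christoffel map of the upper half plane onto the triangle with vertices $0$, $a$, $b\,e^{i\pi/5}$). The metric $\Gamma$ on $S_{\mathrm{reg}}$ is the restriction to $S_{\mathrm{reg}}$ of $\frac{k}{\eta}\,d\xi\odot\frac{k}{\overline{\eta}}\,\overline{d\xi}$; that is, for real tangent vectors $v,w$ to $S_{\mathrm{reg}}$ at $(\xi,\eta)$, $\Gamma(\xi,\eta)(v,w)=\frac{k^2}{|\eta|^2}\,\mathrm{Re}\big(d\xi(v)\,\overline{d\xi(w)}\big)$. *)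

theory Defs
  imports "HOL-Analysis.Analysis"
begin

text \<open>For open \<open>S\<close>: \<open>C\<^sup>k\<close> and smooth maps, via iterated directional derivatives.\<close>

primrec Ck_on :: "nat \<Rightarrow> ('a::euclidean_space \<Rightarrow> 'b::real_normed_vector) \<Rightarrow> 'a set \<Rightarrow> bool" where
  "Ck_on 0 f S \<longleftrightarrow> continuous_on S f"
| "Ck_on (Suc n) f S \<longleftrightarrow> (\<forall>x\<in>S. f differentiable (at x)) \<and>
      (\<forall>v. Ck_on n (\<lambda>x. frechet_derivative f (at x) v) S)"

definition smooth_on :: "('a::euclidean_space \<Rightarrow> 'b::real_normed_vector) \<Rightarrow> 'a set \<Rightarrow> bool" where
  "smooth_on f S \<longleftrightarrow> (\<forall>n. Ck_on n f S)"

text \<open>\<open>\<phi>\<close> is the inverse of a chart of the two-dimensional embedded submanifold \<open>M\<close>: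
  a smooth immersion of the open set \<open>V\<close> that is a homeomorphism onto an open subset of \<open>M\<close>.\<close>

definition local_parametrization ::
  "'a::euclidean_space set \<Rightarrow> (real^2) set \<Rightarrow> (real^2 \<Rightarrow> 'a) \<Rightarrow> bool" where
  "local_parametrization M V \<phi> \<longleftrightarrow>
     open V \<and> openin (top_of_set M) (\<phi> ` V) \<and> smooth_on \<phi> V \<and>
     (\<forall>x\<in>V. inj (frechet_derivative \<phi> (at x))) \<and>
     (\<exists>\<psi>. homeomorphism V (\<phi> ` V) \<phi> \<psi>)"

text \<open>A metric on a submanifold of \<open>'a\<close> is given as \<open>g p v w\<close>, where \<open>v\<close>, \<open>w\<close> are ambient vectors
  tangent to the submanifold at \<open>p\<close>; its values on other vectors are never used.\<close>

type_synonym 'a metric_tensor = "'a \<Rightarrow> 'a \<Rightarrow> 'a \<Rightarrow> real"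

definition metric_coeffs ::
  "'a::real_normed_vector metric_tensor \<Rightarrow> (real^'n \<Rightarrow> 'a) \<Rightarrow> real^'n \<Rightarrow> real^'n^'n" where
  "metric_coeffs g \<phi> x =
     (\<chi> i j. g (\<phi> x) (frechet_derivative \<phi> (at x) (axis i 1))
                     (frechet_derivative \<phi> (at x) (axis j 1)))"

definition partial_deriv :: "'n::finite \<Rightarrow> (real^'n \<Rightarrow> real) \<Rightarrow> real^'n \<Rightarrow> real" where
  "partial_deriv i f x = frechet_derivative f (at x) (axis i 1)"

text \<open>\<open>christoffel G l i j x\<close> is the component \<open>l\<close> of \<open>\<nabla>\<^sub>i \<partial>\<^sub>j\<close> for the Levi-Civita connection
  of the metric with coefficient matrix \<open>G\<close>.\<close>

definition christoffel ::
  "(real^'n \<Rightarrow> real^'n^'n) \<Rightarrow> 'n \<Rightarrow> 'n \<Rightarrow> 'n \<Rightarrow> real^'n \<Rightarrow> real" where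
  "christoffel G l i j x =
     (\<Sum>m\<in>UNIV. matrix_inv (G x) $ l $ m *
        (partial_deriv i (\<lambda>y. G y $ j $ m) x
         + partial_deriv j (\<lambda>y. G y $ i $ m) x
         - partial_deriv m (\<lambda>y. G y $ i $ j) x)) / 2"

text \<open>\<open>riemann_curvature G l i j k x\<close> is the component \<open>l\<close> of \<open>R(\<partial>\<^sub>i, \<partial>\<^sub>j) \<partial>\<^sub>k\<close>.\<close>

definition riemann_curvature ::
  "(real^'n \<Rightarrow> real^'n^'n) \<Rightarrow> 'n \<Rightarrow> 'n \<Rightarrow> 'n \<Rightarrow> 'n \<Rightarrow> real^'n \<Rightarrow> real" where
  "riemann_curvature G l i j k x =
     partial_deriv i (christoffel G l j k) x - partial_deriv j (christoffel G l i k) x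
     + (\<Sum>m\<in>UNIV. christoffel G m j k x * christoffel G l i m x
                   - christoffel G m i k x * christoffel G l j m x)"

text \<open>Flatness of a Riemannian metric \<open>g\<close> on a two-dimensional submanifold \<open>M\<close>: the Riemann
  curvature tensor vanishes at every point, in every chart. The first conjunct makes the
  condition non-vacuous: every point has to lie in a chart.\<close>

definition flat_metric_on :: "'a::euclidean_space set \<Rightarrow> 'a metric_tensor \<Rightarrow> bool" where
  "flat_metric_on M g \<longleftrightarrow>
     (\<forall>p\<in>M. \<exists>V \<phi>. local_parametrization M V \<phi> \<and> p \<in> \<phi> ` V) \<and>
     (\<forall>V \<phi>. local_parametrization M V \<phi> \<longrightarrow>
        (\<forall>x\<in>V. \<forall>l i j k. riemann_curvature (metric_coeffs g \<phi>) l i j k x = 0))"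

definition vertex_a :: real where
  "vertex_a = 2 * cos (2 * pi / 5)"

definition vertex_b :: real where
  "vertex_b = 2 * cos (pi / 5)"

definition f_poly :: "complex \<Rightarrow> complex" where
  "f_poly \<xi> = \<xi> ^ 8 * (\<xi> - of_real vertex_a) ^ 3 * (\<xi> - of_real vertex_b) ^ 9"

definition S_curve :: "(complex \<times> complex) set" where
  "S_curve = {(\<xi>, \<eta>). \<eta> ^ 10 = f_poly \<xi>}"

definition S_reg :: "(complex \<times> complex) set" where
  "S_reg = S_curve - {(0, 0), (of_real vertex_a, 0), (of_real vertex_b, 0)}"

text \<open>The normalizing constant of the Schwarz-Christoffel map. The values of the integrand at the
  endpoints, where \<open>powr\<close> returns \<open>0\<close>, do not matter.\<close>

definition sc_const :: real where
  "sc_const = vertex_a /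
     integral {0..vertex_a}
       (\<lambda>x. x powr (- 4 / 5) * (vertex_a - x) powr (- 3 / 10) * (vertex_b - x) powr (- 9 / 10))"

definition Gamma_metric :: "(complex \<times> complex) metric_tensor" where
  "Gamma_metric p v w = sc_const\<^sup>2 / (cmod (snd p))\<^sup>2 * Re (fst v * cnj (fst w))"

end

theory Submission
  imports Defs "HOL-Complex_Analysis.Cauchy_Integral_Formula"
begin

text \<open>The metric is \<open>k\<^sup>2 |\<omega>|\<^sup>2\<close> for the holomorphic form \<open>\<omega> = d\<xi>/\<eta>\<close>. On a curve every holomorphic
  form is closed: differentiating \<open>\<eta>\<^sup>1\<^sup>0 = f(\<xi>)\<close> shows that \<open>d\<eta>\<close> is a complex multiple of \<open>d\<xi>\<close>
  where \<open>\<eta> \<noteq> 0\<close>, so \<open>d\<omega> = - d\<eta> \<and> d\<xi> / \<eta>\<^sup>2 = 0\<close>. Hence \<open>\<omega> = dF\<close> locally, and \<open>kF\<close> is a local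
  isometry into the Euclidean plane.

  The proof stays at the level of \<open>\<omega>\<close> and never integrates it. Let \<open>P\<^sub>i\<close> be the value of \<open>k\<omega>\<close> on
  the coordinate field \<open>\<partial>\<^sub>i\<close> of a chart. The \<open>P\<^sub>i\<close> form a real basis of the complex plane at each
  point, the metric coefficients are their inner products, and closedness says
  \<open>\<partial>\<^sub>i P\<^sub>j = \<partial>\<^sub>j P\<^sub>i\<close>. The defining formula of the Christoffel symbols then reduces to
  \<open>\<partial>\<^sub>i P\<^sub>j = \<Sum>\<^sub>l \<Gamma>\<^sup>l\<^sub>i\<^sub>j P\<^sub>l\<close> (\<open>D_expansion\<close>), which says that the \<open>P\<^sub>l\<close> turn the Levi-Civita connection
  into ordinary differentiation of vector-valued functions. Differentiating this once more yields
  \<open>\<Sum>\<^sub>l R\<^sup>l\<^sub>i\<^sub>j\<^sub>k P\<^sub>l = \<partial>\<^sub>i \<partial>\<^sub>j P\<^sub>k - \<partial>\<^sub>j \<partial>\<^sub>i P\<^sub>k\<close>, so the curvature vanishes because second derivatives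
  are symmetric (\<open>riemann_curvature_zero\<close>).

  Flatness also demands that charts cover the curve. Near a point with \<open>\<eta> \<noteq> 0\<close> a branch of the
  tenth root of \<open>f\<close> presents it as the graph of a holomorphic function of \<open>\<xi>\<close>
  (\<open>S_reg_chart_exists\<close>).\<close>

section \<open>Symmetry of second derivatives\<close>

lemma has_derivative_along_line:
  fixes f :: "'a::real_normed_vector \<Rightarrow> 'b::real_normed_vector"
  assumes "f differentiable (at (p + s *\<^sub>R u))"
  shows "((\<lambda>t. f (p + t *\<^sub>R u)) has_derivative
          (\<lambda>h. h *\<^sub>R frechet_derivative f (at (p + s *\<^sub>R u)) u)) (at s)"
proof -
  have f: "(f has_derivative frechet_derivative f (at (p + s *\<^sub>R u))) (at (p + s *\<^sub>R u))"
    using assms by (simp add: frechet_derivative_works)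
  have "((\<lambda>t. p + t *\<^sub>R u) has_derivative (\<lambda>h. h *\<^sub>R u)) (at s)"
    by (auto intro!: derivative_eq_intros)
  from has_derivative_compose[OF this f] show ?thesis
    by (simp add: linear_cmul[OF has_derivative_linear[OF f]])
qed

text \<open>The mean value theorem twice, first in the direction of \<open>u\<close> and then of \<open>v\<close>. The second
  difference itself is symmetric in \<open>u\<close> and \<open>v\<close>; comparing the results of both orders is what makes
  mixed derivatives agree.\<close>

lemma second_difference_eq:
  fixes f :: "'a::real_normed_vector \<Rightarrow> real"
  assumes h: "h > 0"
    and S: "\<And>s t. \<lbrakk>0 \<le> s; s \<le> h; 0 \<le> t; t \<le> h\<rbrakk> \<Longrightarrow> x + s *\<^sub>R u + t *\<^sub>R v \<in> S"
    and f: "\<And>y. y \<in> S \<Longrightarrow> f differentiable (at y)"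
    and fu: "\<And>y. y \<in> S \<Longrightarrow> (\<lambda>z. frechet_derivative f (at z) u) differentiable (at y)"
  obtains s t where "0 < s" "s < h" "0 < t" "t < h"
    "f (x + h *\<^sub>R u + h *\<^sub>R v) - f (x + h *\<^sub>R u) - f (x + h *\<^sub>R v) + f x
     = h\<^sup>2 * frechet_derivative (\<lambda>z. frechet_derivative f (at z) u) (at (x + s *\<^sub>R u + t *\<^sub>R v)) v"
proof -
  define fu where "fu = (\<lambda>z. frechet_derivative f (at z) u)"
  define p where "p s = f (x + h *\<^sub>R v + s *\<^sub>R u) - f (x + s *\<^sub>R u)" for s
  have p: "(p has_derivative (\<lambda>r. r *\<^sub>R (fu (x + h *\<^sub>R v + s *\<^sub>R u) - fu (x + s *\<^sub>R u)))) (at s)"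
    if "0 \<le> s" "s \<le> h" for s
    unfolding p_def fu_def scaleR_diff_right
  proof (intro has_derivative_diff has_derivative_along_line f)
    show "x + h *\<^sub>R v + s *\<^sub>R u \<in> S" using S[of s h] that h by (simp add: algebra_simps)
    show "x + s *\<^sub>R u \<in> S" using S[of s 0] that h by simp
  qed
  have "\<exists>s\<in>{0<..<h}. p h - p 0 = (h - 0) *\<^sub>R (fu (x + h *\<^sub>R v + s *\<^sub>R u) - fu (x + s *\<^sub>R u))"
  proof (rule mvt[OF h, where f' = "\<lambda>s r. r *\<^sub>R (fu (x + h *\<^sub>R v + s *\<^sub>R u) - fu (x + s *\<^sub>R u))"])
    show "continuous_on {0..h} p"
      by (rule has_derivative_continuous_on[OF has_derivative_at_withinI[OF p]]) auto
  qed (use p in auto)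
  then obtain s where s: "0 < s" "s < h"
    and ps: "p h - p 0 = h * (fu (x + h *\<^sub>R v + s *\<^sub>R u) - fu (x + s *\<^sub>R u))" by auto
  define q where "q t = fu (x + s *\<^sub>R u + t *\<^sub>R v)" for t
  have q: "(q has_derivative (\<lambda>r. r *\<^sub>R frechet_derivative fu (at (x + s *\<^sub>R u + t *\<^sub>R v)) v)) (at t)"
    if "0 \<le> t" "t \<le> h" for t
    unfolding q_def using S[of s t] that s fu by (intro has_derivative_along_line) (auto simp: fu_def)
  have "\<exists>t\<in>{0<..<h}. q h - q 0 = (h - 0) *\<^sub>R frechet_derivative fu (at (x + s *\<^sub>R u + t *\<^sub>R v)) v"
  proof (rule mvt[OF h, where f' = "\<lambda>t r. r *\<^sub>R frechet_derivative fu (at (x + s *\<^sub>R u + t *\<^sub>R v)) v"])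
    show "continuous_on {0..h} q"
      by (rule has_derivative_continuous_on[OF has_derivative_at_withinI[OF q]]) auto
  qed (use q in auto)
  then obtain t where t: "0 < t" "t < h"
    and qt: "q h - q 0 = h * frechet_derivative fu (at (x + s *\<^sub>R u + t *\<^sub>R v)) v" by auto
  have "p h - p 0 = h\<^sup>2 * frechet_derivative fu (at (x + s *\<^sub>R u + t *\<^sub>R v)) v"
    using ps qt by (simp add: q_def power2_eq_square algebra_simps)
  then show ?thesis using that[OF s t] by (simp add: p_def fu_def algebra_simps)
qed

text \<open>The intermediate points of the mean value theorem differ for the two orders of
  differentiation and depend on the step size, so the two mixed derivatives are only
  known to share values arbitrarily close to the point.\<close>

lemma eq_if_values_meet_near:
  fixes F G :: "'a::metric_space \<Rightarrow> 'b::metric_space"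
  assumes F: "isCont F x" and G: "isCont G x"
    and meet: "\<And>d. d > 0 \<Longrightarrow> \<exists>y z. dist y x < d \<and> dist z x < d \<and> F y = G z"
  shows "F x = G x"
proof (rule ccontr)
  assume "F x \<noteq> G x"
  then have e: "dist (F x) (G x) / 2 > 0" by simp
  obtain d1 where d1: "d1 > 0" "\<And>y. dist y x < d1 \<Longrightarrow> dist (F y) (F x) < dist (F x) (G x) / 2"
    using F e unfolding continuous_at_eps_delta by blast
  obtain d2 where d2: "d2 > 0" "\<And>y. dist y x < d2 \<Longrightarrow> dist (G y) (G x) < dist (F x) (G x) / 2"
    using G e unfolding continuous_at_eps_delta by blast
  obtain y z where yz: "dist y x < min d1 d2" "dist z x < min d1 d2" "F y = G z"
    using meet[of "min d1 d2"] d1 d2 by auto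
  have "dist (F x) (G x) \<le> dist (F y) (F x) + dist (G z) (G x)"
    using dist_triangle[of "F x" "G x" "F y"] yz(3) by (simp add: dist_commute)
  then show False using d1(2)[of y] d2(2)[of z] yz by auto
qed

lemma symmetric_second_derivative_real:
  fixes f :: "'a::real_normed_vector \<Rightarrow> real"
  assumes S: "open S" "x \<in> S"
    and f: "\<And>y. y \<in> S \<Longrightarrow> f differentiable (at y)"
    and f': "\<And>y w. y \<in> S \<Longrightarrow> (\<lambda>z. frechet_derivative f (at z) w) differentiable (at y)"
    and f'': "\<And>w w'. continuous_on S (\<lambda>y. frechet_derivative (\<lambda>z. frechet_derivative f (at z) w) (at y) w')"
  shows "frechet_derivative (\<lambda>z. frechet_derivative f (at z) u) (at x) v
       = frechet_derivative (\<lambda>z. frechet_derivative f (at z) v) (at x) u"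
proof (rule eq_if_values_meet_near
    [where F = "\<lambda>y. frechet_derivative (\<lambda>z. frechet_derivative f (at z) u) (at y) v"
       and G = "\<lambda>y. frechet_derivative (\<lambda>z. frechet_derivative f (at z) v) (at y) u"])
  show "isCont (\<lambda>y. frechet_derivative (\<lambda>z. frechet_derivative f (at z) u) (at y) v) x"
       "isCont (\<lambda>y. frechet_derivative (\<lambda>z. frechet_derivative f (at z) v) (at y) u) x"
    using f'' S continuous_on_eq_continuous_at by blast+
  fix d :: real assume d: "d > 0"
  obtain e where e: "e > 0" "ball x e \<subseteq> S" using S openE by blast
  \<comment> \<open>The summand \<open>1\<close> keeps \<open>N\<close> positive if both directions vanish; the parallelogram with
    sides \<open>h u\<close> and \<open>h v\<close> then lies within
    distance \<open>min d e / 2\<close> of \<open>x\<close>.\<close>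
  define N where "N = norm u + norm v + 1"
  define h where "h = min d e / (2 * N)"
  have N: "N > 0" unfolding N_def by (smt (verit) norm_ge_zero)
  have h: "h > 0" using d e N by (simp add: h_def)
  have near: "dist (x + s *\<^sub>R u + t *\<^sub>R v) x < min d e" if "0 \<le> s" "s \<le> h" "0 \<le> t" "t \<le> h" for s t
  proof -
    have "norm (s *\<^sub>R u + t *\<^sub>R v) \<le> s * norm u + t * norm v"
      using norm_triangle_ineq[of "s *\<^sub>R u" "t *\<^sub>R v"] that by simp
    also have "\<dots> \<le> h * norm u + h * norm v"
      using that by (intro add_mono mult_right_mono) auto
    also have "\<dots> \<le> h * N" using h by (simp add: N_def algebra_simps)
    also have "\<dots> = min d e / 2" using N by (simp add: h_def)
    also have "\<dots> < min d e" using d e by auto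
    finally show ?thesis by (simp add: dist_norm add.assoc)
  qed
  have inS: "x + s *\<^sub>R u + t *\<^sub>R v \<in> S" if "0 \<le> s" "s \<le> h" "0 \<le> t" "t \<le> h" for s t
    using near[OF that] e by (auto simp: dist_commute subset_iff)
  have inS': "x + s *\<^sub>R v + t *\<^sub>R u \<in> S" if "0 \<le> s" "s \<le> h" "0 \<le> t" "t \<le> h" for s t
    using inS[of t s] that by (simp add: algebra_simps)
  obtain s t where st: "0 < s" "s < h" "0 < t" "t < h"
    "f (x + h *\<^sub>R u + h *\<^sub>R v) - f (x + h *\<^sub>R u) - f (x + h *\<^sub>R v) + f x
     = h\<^sup>2 * frechet_derivative (\<lambda>z. frechet_derivative f (at z) u) (at (x + s *\<^sub>R u + t *\<^sub>R v)) v"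
    by (rule second_difference_eq[OF h inS f f'])
  obtain t' s' where st': "0 < t'" "t' < h" "0 < s'" "s' < h"
    "f (x + h *\<^sub>R v + h *\<^sub>R u) - f (x + h *\<^sub>R v) - f (x + h *\<^sub>R u) + f x
     = h\<^sup>2 * frechet_derivative (\<lambda>z. frechet_derivative f (at z) v) (at (x + t' *\<^sub>R v + s' *\<^sub>R u)) u"
    by (rule second_difference_eq[OF h inS' f f'])
  have swap: "x + h *\<^sub>R v + h *\<^sub>R u = x + h *\<^sub>R u + h *\<^sub>R v"
    "x + t' *\<^sub>R v + s' *\<^sub>R u = x + s' *\<^sub>R u + t' *\<^sub>R v" by (simp_all add: algebra_simps)
  define X where "X = frechet_derivative (\<lambda>z. frechet_derivative f (at z) u) (at (x + s *\<^sub>R u + t *\<^sub>R v)) v"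
  define Y where "Y = frechet_derivative (\<lambda>z. frechet_derivative f (at z) v) (at (x + s' *\<^sub>R u + t' *\<^sub>R v)) u"
  have "h\<^sup>2 * X = h\<^sup>2 * Y"
    using st(5) st'(5) unfolding swap X_def[symmetric] Y_def[symmetric] by linarith
  then have "X = Y" using h by simp
  moreover have "dist (x + s *\<^sub>R u + t *\<^sub>R v) x < d" "dist (x + s' *\<^sub>R u + t' *\<^sub>R v) x < d"
    using near[of s t] near[of s' t'] st(1-4) st'(1-4) by simp_all
  ultimately show "\<exists>y z. dist y x < d \<and> dist z x < d \<and>
      frechet_derivative (\<lambda>z. frechet_derivative f (at z) u) (at y) v
    = frechet_derivative (\<lambda>z. frechet_derivative f (at z) v) (at z) u"
    unfolding X_def Y_def by blast
qed

section \<open>Calculus of continuously differentiable maps\<close>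

lemma Ck_on_cong:
  assumes "open S" "\<And>x. x \<in> S \<Longrightarrow> f x = g x"
  shows "Ck_on n f S \<longleftrightarrow> Ck_on n g S"
  using assms(2)
proof (induction n arbitrary: f g)
  case 0
  then show ?case by (simp cong: continuous_on_cong)
next
  case (Suc n)
  have eq: "(f has_derivative F) (at x) \<longleftrightarrow> (g has_derivative F) (at x)" if "x \<in> S" for x F
    using has_derivative_transform_within_open[OF _ assms(1) that, of f F UNIV g]
      has_derivative_transform_within_open[OF _ assms(1) that, of g F UNIV f] Suc.prems by auto
  have D: "f differentiable (at x) \<longleftrightarrow> g differentiable (at x)" if "x \<in> S" for x
    using eq[OF that] by (simp add: differentiable_def)
  have E: "frechet_derivative f (at x) = frechet_derivative g (at x)" if "x \<in> S" for x
    using eq[OF that] by (simp add: frechet_derivative_def)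
  have "Ck_on n (\<lambda>x. frechet_derivative f (at x) v) S \<longleftrightarrow>
        Ck_on n (\<lambda>x. frechet_derivative g (at x) v) S" for v
    by (rule Suc.IH) (simp add: E)
  with D show ?case by simp
qed

text \<open>Introduces \<open>C\<^sup>n\<^sup>+\<^sup>1\<close> from any known derivative, without mentioning the selected
  \<open>frechet_derivative\<close>; the closure properties below all rest on it.\<close>

lemma Ck_on_SucI:
  assumes "open S" "\<And>x. x \<in> S \<Longrightarrow> (f has_derivative F x) (at x)"
    and "\<And>v. Ck_on n (\<lambda>x. F x v) S"
  shows "Ck_on (Suc n) f S"
proof -
  have "Ck_on n (\<lambda>x. frechet_derivative f (at x) v) S" for v
    using assms(3)[of v] frechet_derivative_at[OF assms(2)]
    by (subst Ck_on_cong[OF assms(1), where g = "\<lambda>x. F x v"]) auto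
  then show ?thesis using assms(2) by (auto simp: differentiable_def)
qed

lemma Ck_on_has_derivative:
  assumes "Ck_on (Suc n) f S" "x \<in> S"
  shows "(f has_derivative frechet_derivative f (at x)) (at x)"
  using assms by (simp add: frechet_derivative_works)

lemma Ck_on_SucD:
  assumes "Ck_on (Suc n) f S"
  shows "Ck_on n f S"
  using assms
proof (induction n arbitrary: f)
  case 0
  then show ?case
    by (auto intro!: continuous_at_imp_continuous_on differentiable_imp_continuous_within)
qed auto

lemma Ck_on_const: "Ck_on n (\<lambda>x. c) S"
  by (induction n arbitrary: c) auto

lemma Ck_on_add:
  assumes "open S" "Ck_on n f S" "Ck_on n g S"
  shows "Ck_on n (\<lambda>x. f x + g x) S"
  using assms(2,3)
proof (induction n arbitrary: f g)
  case 0
  then show ?case by (simp add: continuous_on_add)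
next
  case (Suc n)
  show ?case
    by (rule Ck_on_SucI[OF assms(1) has_derivative_add])
       (use Suc in \<open>auto simp: frechet_derivative_works\<close>)
qed

lemma Ck_on_bounded_linear:
  assumes L: "bounded_linear L" and S: "open S" and g: "Ck_on n g S"
  shows "Ck_on n (\<lambda>x. L (g x)) S"
  using g
proof (induction n arbitrary: g)
  case 0
  then show ?case by (simp add: bounded_linear.continuous_on[OF L])
next
  case (Suc n)
  show ?case
    by (rule Ck_on_SucI[OF S bounded_linear.has_derivative[OF L]])
       (use Suc in \<open>auto simp: frechet_derivative_works\<close>)
qed

lemma Ck_on_bounded_bilinear:
  assumes B: "bounded_bilinear B" and S: "open S" and f: "Ck_on n f S" and g: "Ck_on n g S"
  shows "Ck_on n (\<lambda>x. B (f x) (g x)) S"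
  using f g
proof (induction n arbitrary: f g)
  case 0
  then show ?case by (simp add: bounded_bilinear.continuous_on[OF B])
next
  case (Suc n)
  have fg: "Ck_on n f S" "Ck_on n g S"
    using Suc.prems by (blast intro: Ck_on_SucD)+
  show ?case
  proof (rule Ck_on_SucI[OF S bounded_bilinear.FDERIV[OF B]])
    show "Ck_on n (\<lambda>x. B (f x) (frechet_derivative g (at x) v) + B (frechet_derivative f (at x) v) (g x)) S"
      for v
      using Suc.prems fg by (intro Ck_on_add Suc.IH S) auto
  qed (use Suc.prems in \<open>auto simp: frechet_derivative_works\<close>)
qed

lemma Ck_on_inverse:
  fixes f :: "'a::euclidean_space \<Rightarrow> 'b::real_normed_field"
  assumes "open S" "Ck_on n f S" "\<And>x. x \<in> S \<Longrightarrow> f x \<noteq> 0"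
  shows "Ck_on n (\<lambda>x. inverse (f x)) S"
  using assms(2,3)
proof (induction n arbitrary: f)
  case 0
  then show ?case by (simp add: continuous_on_inverse)
next
  case (Suc n)
  show ?case
  proof (rule Ck_on_SucI[OF assms(1) Deriv.has_derivative_inverse])
    have "Ck_on n (\<lambda>x. inverse (f x)) S"
      using Suc by (blast dest: Ck_on_SucD)
    then show "Ck_on n (\<lambda>x. - (inverse (f x) * frechet_derivative f (at x) v * inverse (f x))) S" for v
      using Suc.prems
      by (intro Ck_on_bounded_linear[OF bounded_linear_minus[OF bounded_linear_ident]]
           Ck_on_bounded_bilinear[OF bounded_bilinear_mult] assms(1)) auto
  qed (use Suc.prems in \<open>auto simp: frechet_derivative_works\<close>)
qed

lemma Ck_on_Pair:
  assumes "open S" "Ck_on n f S" "Ck_on n g S"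
  shows "Ck_on n (\<lambda>x. (f x, g x)) S"
  using assms(2,3)
proof (induction n arbitrary: f g)
  case 0
  then show ?case by (simp add: continuous_on_Pair)
next
  case (Suc n)
  show ?case
    by (rule Ck_on_SucI[OF assms(1) has_derivative_Pair])
       (use Suc in \<open>auto simp: frechet_derivative_works\<close>)
qed

text \<open>The derivative in direction \<open>v\<close> is \<open>deriv h\<close> composed with \<open>L\<close>, times the constant \<open>L v\<close>.
  As \<open>deriv h\<close> is again holomorphic, the induction closes.\<close>

lemma Ck_on_holomorphic_linear:
  fixes L :: "'a::euclidean_space \<Rightarrow> complex"
  assumes L: "bounded_linear L" and U: "open U" and h: "h holomorphic_on U"
  shows "Ck_on n (\<lambda>x. h (L x)) (L -` U)"
  using h
proof (induction n arbitrary: h)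
  case 0
  then show ?case
    using continuous_on_compose2[OF holomorphic_on_imp_continuous_on linear_continuous_on[OF L]]
    by auto
next
  case (Suc n)
  have opn: "open (L -` U)"
    using L U by (intro open_vimage linear_continuous_on)
  show ?case
  proof (rule Ck_on_SucI[OF opn, where F = "\<lambda>x v. deriv h (L x) * L v"])
    fix x assume "x \<in> L -` U"
    then have "(h has_field_derivative deriv h (L x)) (at (L x))"
      using Suc.prems U by (simp add: holomorphic_derivI)
    then show "((\<lambda>x. h (L x)) has_derivative (\<lambda>v. deriv h (L x) * L v)) (at x)"
      using has_derivative_compose[OF bounded_linear_imp_has_derivative[OF L]]
      by (simp add: has_field_derivative_def)
  next
    have "Ck_on n (\<lambda>x. deriv h (L x)) (L -` U)"
      by (rule Suc.IH) (rule holomorphic_deriv[OF Suc.prems U])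
    from Ck_on_bounded_linear[OF bounded_linear_mult_left opn this]
    show "Ck_on n (\<lambda>x. deriv h (L x) * L v) (L -` U)" for v .
  qed
qed

text \<open>As an equation, the mean value theorem holds for real functions only, so the real case is
  applied to each component.\<close>

lemma symmetric_second_derivative:
  fixes f :: "'a::euclidean_space \<Rightarrow> 'b::euclidean_space"
  assumes S: "open S" "x \<in> S" and f: "Ck_on (Suc (Suc 0)) f S"
  shows "frechet_derivative (\<lambda>z. frechet_derivative f (at z) u) (at x) v
       = frechet_derivative (\<lambda>z. frechet_derivative f (at z) v) (at x) u"
proof (rule euclidean_eqI)
  fix b :: 'b
  let ?g = "\<lambda>x. f x \<bullet> b"
  have g: "Ck_on (Suc (Suc 0)) ?g S"
    by (rule Ck_on_bounded_linear[OF bounded_linear_inner_left S(1) f])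
  have g1: "frechet_derivative ?g (at z) w = frechet_derivative f (at z) w \<bullet> b"
    if "z \<in> S" for z w
    using frechet_derivative_at[OF has_derivative_inner_left[OF Ck_on_has_derivative[OF f that], of b]] by metis
  have g2: "frechet_derivative (\<lambda>z. frechet_derivative ?g (at z) w) (at x) w'
     = frechet_derivative (\<lambda>z. frechet_derivative f (at z) w) (at x) w' \<bullet> b" for w w'
  proof -
    have "Ck_on (Suc 0) (\<lambda>z. frechet_derivative f (at z) w) S" using f by simp
    from has_derivative_inner_left[OF Ck_on_has_derivative[OF this S(2)], of b]
    have "((\<lambda>z. frechet_derivative ?g (at z) w) has_derivative
       (\<lambda>w'. frechet_derivative (\<lambda>z. frechet_derivative f (at z) w) (at x) w' \<bullet> b)) (at x)"
      by (rule has_derivative_transform_within_open[OF _ S]) (simp add: g1)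
    from frechet_derivative_at[OF this] show ?thesis by metis
  qed
  have "frechet_derivative (\<lambda>z. frechet_derivative ?g (at z) u) (at x) v
      = frechet_derivative (\<lambda>z. frechet_derivative ?g (at z) v) (at x) u"
    by (rule symmetric_second_derivative_real[OF S]) (use g in simp_all)
  then show "frechet_derivative (\<lambda>z. frechet_derivative f (at z) u) (at x) v \<bullet> b
      = frechet_derivative (\<lambda>z. frechet_derivative f (at z) v) (at x) u \<bullet> b"
    unfolding g2 .
qed

section \<open>Metrics with a closed orthonormal coframe\<close>

lemma differentiable_det:
  fixes A :: "'a::real_normed_vector \<Rightarrow> real^'n^'n"
  assumes "\<And>i j. (\<lambda>y. A y $ i $ j) differentiable (at x)"
  shows "(\<lambda>y. det (A y)) differentiable (at x)"
proof -
  have "(\<lambda>y. \<Prod>i\<in>I. A y $ i $ p i) differentiable (at x)" if "finite I" for I :: "'n set" and p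
    using that by induction (auto intro!: differentiable_mult assms)
  then show ?thesis
    unfolding det_def by (auto intro!: differentiable_sum differentiable_mult)
qed

lemma matrix_inv_mult_left: "invertible A \<Longrightarrow> matrix_inv A ** A = mat 1"
  unfolding invertible_def matrix_inv_def by (rule conjunct2[OF someI_ex])

lemma partial_deriv_eqI:
  "(f has_derivative F) (at x) \<Longrightarrow> partial_deriv i f x = F (axis i 1)"
  unfolding partial_deriv_def by (metis frechet_derivative_at)

text \<open>\<open>P i\<close> is the coefficient \<open>\<omega>(\<partial>\<^sub>i)\<close> of a 1-form \<open>\<omega>\<close> on \<open>V\<close> with values in a Euclidean space. The
  third assumption is \<open>d\<omega> = 0\<close>. The next two say that \<open>\<omega>\<close> is an isomorphism at each point, and the
  last that \<open>G\<close> is the pullback of the inner product under it. In coordinates of the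
  Euclidean space this is a closed orthonormal coframe.\<close>

locale closed_coframe =
  fixes V :: "(real^'n::finite) set" and P :: "'n \<Rightarrow> real^'n \<Rightarrow> 'e::euclidean_space"
    and G :: "real^'n \<Rightarrow> real^'n^'n"
  assumes open_V: "open V"
    and C2: "Ck_on (Suc (Suc 0)) (P i) V"
    and closed_form: "x \<in> V \<Longrightarrow>
          frechet_derivative (P j) (at x) (axis i 1) = frechet_derivative (P i) (at x) (axis j 1)"
    and independent: "x \<in> V \<Longrightarrow> (\<Sum>l\<in>UNIV. c l *\<^sub>R P l x) = 0 \<Longrightarrow> c l = 0"
    and spanning: "x \<in> V \<Longrightarrow> \<exists>c. w = (\<Sum>l\<in>UNIV. c l *\<^sub>R P l x)"
    and gram: "x \<in> V \<Longrightarrow> G x = (\<chi> i j. P i x \<bullet> P j x)"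
begin

definition D :: "'n \<Rightarrow> 'n \<Rightarrow> real^'n \<Rightarrow> 'e" where
  "D i j x = frechet_derivative (P j) (at x) (axis i 1)"

lemma D_commute: "x \<in> V \<Longrightarrow> D i j x = D j i x"
  by (simp add: D_def closed_form)

lemma P_has_derivative: "x \<in> V \<Longrightarrow> (P i has_derivative frechet_derivative (P i) (at x)) (at x)"
  using Ck_on_has_derivative[OF C2] .

lemma D_has_derivative:
  "x \<in> V \<Longrightarrow> (D i j has_derivative frechet_derivative (D i j) (at x)) (at x)"
proof -
  have "Ck_on (Suc 0) (D i j) V"
    unfolding D_def [abs_def] using C2[of j] by simp
  then show "x \<in> V \<Longrightarrow> ?thesis" by (rule Ck_on_has_derivative)
qed

lemma second_derivative_commute:
  assumes x: "x \<in> V"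
  shows "frechet_derivative (D j k) (at x) (axis i 1) = frechet_derivative (D i k) (at x) (axis j 1)"
  using symmetric_second_derivative[OF open_V x C2] unfolding D_def [abs_def] .

lemma gram_nth: "x \<in> V \<Longrightarrow> G x $ i $ j = P i x \<bullet> P j x"
  by (simp add: gram)

lemma gram_has_derivative:
  assumes x: "x \<in> V"
  shows "((\<lambda>y. G y $ i $ j) has_derivative
     (\<lambda>v. P i x \<bullet> frechet_derivative (P j) (at x) v + frechet_derivative (P i) (at x) v \<bullet> P j x)) (at x)"
  by (rule has_derivative_transform_within_open[OF _ open_V x,
        OF has_derivative_inner[OF P_has_derivative[OF x] P_has_derivative[OF x]]])
     (simp add: gram_nth)

lemma partial_deriv_gram:
  "x \<in> V \<Longrightarrow> partial_deriv m (\<lambda>y. G y $ i $ j) x = P i x \<bullet> D m j x + D m i x \<bullet> P j x"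
  by (simp add: partial_deriv_eqI[OF gram_has_derivative] D_def)

lemma gram_mult_vec:
  assumes "x \<in> V"
  shows "(G x *v c) $ m = P m x \<bullet> (\<Sum>s\<in>UNIV. c $ s *\<^sub>R P s x)"
  using assms by (simp add: matrix_vector_mult_def gram_nth inner_sum_right mult.commute)

text \<open>A kernel vector \<open>c\<close> gives a combination of the \<open>P\<^sub>s\<close> that is orthogonal to every \<open>P\<^sub>m\<close>, hence
  to itself.\<close>

lemma invertible_gram:
  assumes x: "x \<in> V"
  shows "invertible (G x)"
proof -
  have "c = 0" if "G x *v c = 0" for c
  proof -
    let ?w = "\<Sum>s\<in>UNIV. c $ s *\<^sub>R P s x"
    have "P m x \<bullet> ?w = 0" for m using gram_mult_vec[OF x, of c m] that by simp
    then have "?w \<bullet> ?w = 0"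
      by (subst inner_sum_left) simp
    then have "?w = 0" by simp
    from independent[OF x this] show "c = 0" by (simp add: vec_eq_iff)
  qed
  then show ?thesis
    using matrix_left_invertible_ker[of "G x"] invertible_left_inverse by blast
qed

text \<open>Raising an index with the inverse metric reads off the coefficients with respect to the
  frame.\<close>

lemma coefficients_eq:
  assumes x: "x \<in> V" and c: "w = (\<Sum>l\<in>UNIV. c l *\<^sub>R P l x)"
  shows "(\<Sum>m\<in>UNIV. matrix_inv (G x) $ l $ m * (P m x \<bullet> w)) = c l"
proof -
  have "matrix_inv (G x) *v (\<chi> m. P m x \<bullet> w) = matrix_inv (G x) *v (G x *v (\<chi> l. c l))"
    by (rule arg_cong[where f = "\<lambda>z. matrix_inv (G x) *v z"])
       (simp add: vec_eq_iff gram_mult_vec[OF x] c)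
  also have "\<dots> = (\<chi> l. c l)"
    by (simp add: matrix_vector_mul_assoc matrix_inv_mult_left[OF invertible_gram[OF x]])
  finally show ?thesis by (simp add: vec_eq_iff matrix_vector_mult_def)
qed

text \<open>Each derivative of a metric coefficient is a sum of two products by the Leibniz rule. By
  closedness four of the six terms in the Christoffel symbol cancel, and the other two agree.\<close>

lemma christoffel_eq:
  assumes x: "x \<in> V"
  shows "christoffel G l i j x = (\<Sum>m\<in>UNIV. matrix_inv (G x) $ l $ m * (P m x \<bullet> D i j x))"
proof -
  have "partial_deriv i (\<lambda>y. G y $ j $ m) x + partial_deriv j (\<lambda>y. G y $ i $ m) x
      - partial_deriv m (\<lambda>y. G y $ i $ j) x = 2 * (P m x \<bullet> D i j x)" for m
    using D_commute[OF x, of i j] D_commute[OF x, of m i] D_commute[OF x, of m j]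
    by (simp add: partial_deriv_gram[OF x] inner_commute)
  then show ?thesis
    by (simp add: christoffel_def sum_divide_distrib)
qed

text \<open>The structure equation of the connection in this frame: the Christoffel symbols are the
  coefficients of \<open>\<partial>\<^sub>i P\<^sub>j\<close>.\<close>

lemma D_expansion:
  assumes x: "x \<in> V"
  shows "D i j x = (\<Sum>l\<in>UNIV. christoffel G l i j x *\<^sub>R P l x)"
proof -
  obtain c where c: "D i j x = (\<Sum>l\<in>UNIV. c l *\<^sub>R P l x)"
    using spanning[OF x] by blast
  then show ?thesis
    using coefficients_eq[OF x c] by (simp add: christoffel_eq[OF x])
qed

text \<open>The structure equation cannot be differentiated before its coefficients are known to be
  differentiable. Cramer's rule writes them as quotients of determinants of differentiable
  entries, which avoids differentiating the inverse matrix.\<close>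

lemma christoffel_differentiable:
  assumes x: "x \<in> V"
  shows "christoffel G l i j differentiable (at x)"
proof -
  define N where "N y = (\<chi> r s. if s = l then P r y \<bullet> D i j y else G y $ r $ s)" for y
  have cramer_eq: "det (N y) / det (G y) = christoffel G l i j y" if y: "y \<in> V" for y
  proof -
    have "G y *v (\<chi> l. christoffel G l i j y) = (\<chi> m. P m y \<bullet> D i j y)"
      by (simp add: vec_eq_iff gram_mult_vec[OF y] flip: D_expansion[OF y])
    moreover have "det (G y) \<noteq> 0"
      using invertible_gram[OF y] by (simp add: invertible_det_nz)
    ultimately have "(\<chi> l. christoffel G l i j y)
        = (\<chi> k. det (\<chi> r s. if s = k then (\<chi> m. P m y \<bullet> D i j y) $ r else G y $ r $ s) / det (G y))"
      by (rule iffD1[OF cramer, rotated])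
    from arg_cong[OF this, of "\<lambda>c. c $ l"] show ?thesis
      unfolding N_def by (simp cong: if_cong)
  qed
  have G: "(\<lambda>y. G y $ r $ s) differentiable (at x)" for r s
    using gram_has_derivative[OF x] unfolding differentiable_def by blast
  have "(\<lambda>y. P r y \<bullet> D i j y) differentiable (at x)" for r
    using has_derivative_inner[OF P_has_derivative[OF x] D_has_derivative[OF x]]
    unfolding differentiable_def by blast
  then have N: "(\<lambda>y. N y $ r $ s) differentiable (at x)" for r s
    using G by (cases "s = l") (simp_all add: N_def)
  have "(\<lambda>y. det (N y) / det (G y)) differentiable (at x)"
    using invertible_gram[OF x]
    by (intro differentiable_divide differentiable_det N G) (simp add: invertible_det_nz)
  then obtain F where "((\<lambda>y. det (N y) / det (G y)) has_derivative F) (at x)"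
    unfolding differentiable_def by blast
  then have "(christoffel G l i j has_derivative F) (at x)"
    by (rule has_derivative_transform_within_open[OF _ open_V x cramer_eq])
  then show ?thesis unfolding differentiable_def by blast
qed

lemma derivative_D_expansion:
  assumes x: "x \<in> V"
  shows "frechet_derivative (D j k) (at x) (axis i 1) =
    (\<Sum>l\<in>UNIV. (partial_deriv i (christoffel G l j k) x
        + (\<Sum>m\<in>UNIV. christoffel G m j k x * christoffel G l i m x)) *\<^sub>R P l x)"
proof -
  have \<Gamma>: "(christoffel G l j k has_derivative frechet_derivative (christoffel G l j k) (at x)) (at x)" for l
    using christoffel_differentiable[OF x] by (simp add: frechet_derivative_works)
  have "((\<lambda>y. \<Sum>l\<in>UNIV. christoffel G l j k y *\<^sub>R P l y) has_derivative
     (\<lambda>v. \<Sum>l\<in>UNIV. christoffel G l j k x *\<^sub>R frechet_derivative (P l) (at x) v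
        + frechet_derivative (christoffel G l j k) (at x) v *\<^sub>R P l x)) (at x)"
    by (rule has_derivative_sum[OF has_derivative_scaleR[OF \<Gamma> P_has_derivative[OF x]]])
  then have "(D j k has_derivative
     (\<lambda>v. \<Sum>l\<in>UNIV. christoffel G l j k x *\<^sub>R frechet_derivative (P l) (at x) v
        + frechet_derivative (christoffel G l j k) (at x) v *\<^sub>R P l x)) (at x)"
    by (rule has_derivative_transform_within_open[OF _ open_V x]) (simp add: D_expansion)
  from frechet_derivative_at[OF this, symmetric]
  have "frechet_derivative (D j k) (at x) (axis i 1) =
     (\<Sum>m\<in>UNIV. christoffel G m j k x *\<^sub>R D i m x)
     + (\<Sum>l\<in>UNIV. partial_deriv i (christoffel G l j k) x *\<^sub>R P l x)"
    unfolding D_def partial_deriv_def by (simp only: sum.distrib)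
  also have "(\<Sum>m\<in>UNIV. christoffel G m j k x *\<^sub>R D i m x)
     = (\<Sum>m\<in>UNIV. \<Sum>l\<in>UNIV. (christoffel G m j k x * christoffel G l i m x) *\<^sub>R P l x)"
    by (simp add: D_expansion[OF x] scaleR_sum_right)
  also have "\<dots> = (\<Sum>l\<in>UNIV. (\<Sum>m\<in>UNIV. christoffel G m j k x * christoffel G l i m x) *\<^sub>R P l x)"
    by (subst sum.swap) (simp add: scaleR_sum_left)
  finally show ?thesis
    by (simp only: scaleR_add_left sum.distrib) (rule add.commute)
qed

text \<open>The curvature components are the coefficients of \<open>\<partial>\<^sub>i \<partial>\<^sub>j P\<^sub>k - \<partial>\<^sub>j \<partial>\<^sub>i P\<^sub>k\<close> in the frame.\<close>

theorem riemann_curvature_zero: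
  assumes x: "x \<in> V"
  shows "riemann_curvature G l i j k x = 0"
proof -
  let ?A = "\<lambda>i j l. partial_deriv i (christoffel G l j k) x
        + (\<Sum>m\<in>UNIV. christoffel G m j k x * christoffel G l i m x)"
  have "riemann_curvature G l i j k x = ?A i j l - ?A j i l" for l
    by (simp add: riemann_curvature_def sum_subtractf)
  then have "(\<Sum>l\<in>UNIV. riemann_curvature G l i j k x *\<^sub>R P l x)
     = frechet_derivative (D j k) (at x) (axis i 1) - frechet_derivative (D i k) (at x) (axis j 1)"
    by (simp only: derivative_D_expansion[OF x] scaleR_diff_left sum_subtractf)
  also have "\<dots> = 0" using second_derivative_commute[OF x] by simp
  finally show ?thesis
    by (rule independent[OF x, where c = "\<lambda>l. riemann_curvature G l i j k x"])
qed

end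

section \<open>The coframe given by the form d\<xi>/\<eta>\<close>

lemma f_poly_eq_0_iff: "f_poly \<xi> = 0 \<longleftrightarrow> \<xi> \<in> {0, of_real vertex_a, of_real vertex_b}"
  by (auto simp: f_poly_def)

text \<open>The three removed points are exactly the points of the curve with \<open>\<eta> = 0\<close>, because \<open>0\<close>,
  \<open>a\<close> and \<open>b\<close> are the zeros of \<open>f\<close>.\<close>

lemma S_reg_iff: "p \<in> S_reg \<longleftrightarrow> snd p ^ 10 = f_poly (fst p) \<and> snd p \<noteq> 0"
proof -
  have "snd p ^ 10 = f_poly (fst p) \<Longrightarrow>
     snd p = 0 \<longleftrightarrow> fst p \<in> {0, of_real vertex_a, of_real vertex_b}"
    using f_poly_eq_0_iff[of "fst p"] by (metis power_eq_0_iff zero_less_numeral)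
  then show ?thesis
    by (cases p) (auto simp: S_reg_def S_curve_def)
qed

lemma holomorphic_f_poly: "f_poly holomorphic_on U"
  unfolding f_poly_def [abs_def] by (intro holomorphic_intros)

text \<open>Differentiating the equation of the curve gives \<open>10 \<eta>\<^sup>9 d\<eta> = f'(\<xi>) d\<xi>\<close>. The functions \<open>X\<close> and
  \<open>Y\<close> are the two coordinates along a parametrization.\<close>

lemma d_eta_proportional:
  assumes V: "open V" "x \<in> V"
    and X: "(X has_derivative X') (at x)" and Y: "(Y has_derivative Y') (at x)"
    and curve: "\<And>y. y \<in> V \<Longrightarrow> Y y ^ 10 = f_poly (X y)" and nz: "Y x \<noteq> 0"
  obtains c where "\<And>v. Y' v = c * X' v"
proof -
  have "(f_poly has_field_derivative deriv f_poly (X x)) (at (X x))"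
    by (rule holomorphic_derivI[OF holomorphic_f_poly open_UNIV UNIV_I])
  then have f: "((\<lambda>y. f_poly (X y)) has_derivative (\<lambda>v. deriv f_poly (X x) * X' v)) (at x)"
    using has_derivative_compose[OF X] by (simp add: has_field_derivative_def)
  have "((\<lambda>y. Y y ^ 10) has_derivative (\<lambda>v. of_nat 10 * Y' v * Y x ^ (10 - 1))) (at x)"
    by (rule has_derivative_power[OF Y])
  then have "((\<lambda>y. f_poly (X y)) has_derivative (\<lambda>v. of_nat 10 * Y' v * Y x ^ (10 - 1))) (at x)"
    by (rule has_derivative_transform_within_open[OF _ V curve])
  then have "(\<lambda>v. of_nat 10 * Y' v * Y x ^ (10 - 1)) = (\<lambda>v. deriv f_poly (X x) * X' v)"
    using f by (rule has_derivative_unique)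
  then have "of_nat 10 * Y' v * Y x ^ (10 - 1) = deriv f_poly (X x) * X' v" for v
    by meson
  then have "Y' v = deriv f_poly (X x) / (10 * Y x ^ 9) * X' v" for v
    using nz by (simp add: field_simps)
  then show ?thesis by (rule that)
qed

lemma Re_of_real_mult: "Re (of_real r * z) = r * Re z"
  by simp

lemma inner_eq_Re_mult_cnj: "z \<bullet> w = Re (z * cnj w)"
  by (simp add: inner_complex_def)

lemma inner_scaled_quotients:
  "(of_real k * a * inverse y) \<bullet> (of_real k * b * inverse y) = k\<^sup>2 / (cmod y)\<^sup>2 * Re (a * cnj b)"
proof -
  have "(of_real k * a * inverse y) * cnj (of_real k * b * inverse y)
      = of_real (k\<^sup>2) * (a * cnj b) * inverse (y * cnj y)"
    by (simp add: power2_eq_square)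
  also have "\<dots> = of_real (k\<^sup>2 / (cmod y)\<^sup>2) * (a * cnj b)"
    by (simp add: complex_norm_square[symmetric] field_simps)
  finally have "Re ((of_real k * a * inverse y) * cnj (of_real k * b * inverse y))
      = k\<^sup>2 / (cmod y)\<^sup>2 * Re (a * cnj b)"
    by (simp only: Re_of_real_mult)
  then show ?thesis by (simp only: inner_eq_Re_mult_cnj)
qed

lemma injective_linear_spanning:
  fixes w :: "'n::finite \<Rightarrow> 'e::euclidean_space"
  assumes inj: "\<And>c l. (\<Sum>l\<in>UNIV. c l *\<^sub>R w l) = 0 \<Longrightarrow> c l = 0" and dim: "CARD('n) = DIM('e)"
  shows "\<exists>c. z = (\<Sum>l\<in>UNIV. c l *\<^sub>R w l)"
proof -
  define T where "T c = (\<Sum>l\<in>UNIV. c $ l *\<^sub>R w l)" for c :: "real^'n"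
  have lin: "linear T"
    unfolding T_def by (intro linearI) (simp_all add: scaleR_add_left sum.distrib scaleR_sum_right)
  have "inj T"
    unfolding linear_injective_0[OF lin] T_def using inj by (simp add: vec_eq_iff)
  then have "dim (range T) = DIM('e)"
    using dim_image_eq[OF lin, of UNIV] dim by simp
  then have "span (range T) = UNIV"
    by (simp add: dim_eq_full)
  moreover have "span (range T) = range T"
    by (intro iffD2[OF span_eq_iff] linear_subspace_image[OF lin] subspace_UNIV)
  ultimately have "z \<in> range T" by simp
  then show ?thesis by (auto simp: T_def)
qed

text \<open>Closedness: \<open>\<partial>\<^sub>i(\<xi>\<^sub>j/\<eta>) = \<partial>\<^sub>i\<partial>\<^sub>j\<xi>/\<eta> - \<xi>\<^sub>j \<eta>\<^sub>i/\<eta>\<^sup>2\<close> is symmetric in \<open>i\<close> and \<open>j\<close> because \<open>\<eta>\<^sub>i\<close> is a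
  common multiple of \<open>\<xi>\<^sub>i\<close>. For the same reason a tangent vector with \<open>d\<xi> = 0\<close> has \<open>d\<eta> = 0\<close>, so an
  immersion is already an immersion in the \<open>\<xi>\<close>-plane and the coefficients are independent. Real
  dimension two of the plane turns independence into a basis.\<close>

lemma closed_coframe_Gamma:
  fixes \<phi> :: "real^2 \<Rightarrow> complex \<times> complex"
  assumes V: "open V" and \<phi>: "smooth_on \<phi> V" and S: "\<phi> ` V \<subseteq> S_reg"
    and inj: "\<And>x. x \<in> V \<Longrightarrow> inj (frechet_derivative \<phi> (at x))" and k: "sc_const \<noteq> 0"
  shows "closed_coframe V
    (\<lambda>i x. of_real sc_const * frechet_derivative (\<lambda>y. fst (\<phi> y)) (at x) (axis i 1) * inverse (snd (\<phi> x)))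
    (metric_coeffs Gamma_metric \<phi>)"
proof -
  define X where "X = (\<lambda>x. fst (\<phi> x))"
  define Y where "Y = (\<lambda>x. snd (\<phi> x))"
  define DX where "DX x = frechet_derivative X (at x)" for x
  define DY where "DY x = frechet_derivative Y (at x)" for x
  define P where "P i x = of_real sc_const * DX x (axis i 1) * inverse (Y x)" for i x
  have Ck: "Ck_on n X V" "Ck_on n Y V" for n
    using \<phi> unfolding X_def Y_def smooth_on_def
    by (blast intro: Ck_on_bounded_linear[OF bounded_linear_fst V] Ck_on_bounded_linear[OF bounded_linear_snd V])+
  have CkDX: "Ck_on n (\<lambda>x. DX x v) V" for n v
    using Ck(1)[of "Suc n"] unfolding DX_def by simp
  have curve: "Y x ^ 10 = f_poly (X x)" "Y x \<noteq> 0" if "x \<in> V" for x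
    using S that by (auto simp: X_def Y_def S_reg_iff image_subset_iff)
  have X': "(X has_derivative DX x) (at x)" if "x \<in> V" for x
    unfolding DX_def by (rule Ck_on_has_derivative[OF Ck(1) that])
  have Y': "(Y has_derivative DY x) (at x)" if "x \<in> V" for x
    unfolding DY_def by (rule Ck_on_has_derivative[OF Ck(2) that])
  have D\<phi>: "frechet_derivative \<phi> (at x) = (\<lambda>v. (DX x v, DY x v))" if "x \<in> V" for x
  proof -
    have "(\<phi> has_derivative (\<lambda>v. (DX x v, DY x v))) (at x)"
      using has_derivative_Pair[OF X' Y'] that by (simp add: X_def Y_def)
    then show ?thesis by (rule frechet_derivative_at[symmetric])
  qed
  have "closed_coframe V P (metric_coeffs Gamma_metric \<phi>)"
  proof
    show "open V" by fact
    show "Ck_on (Suc (Suc 0)) (P i) V" for i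
      unfolding P_def
      by (rule Ck_on_bounded_bilinear[OF bounded_bilinear_mult V
           Ck_on_bounded_bilinear[OF bounded_bilinear_mult V Ck_on_const CkDX]
           Ck_on_inverse[OF V Ck(2) curve(2)]])
  next
    fix x assume x: "x \<in> V"
    obtain c where c: "\<And>v. DY x v = c * DX x v"
      using d_eta_proportional[OF V x X'[OF x] Y'[OF x] curve(1) curve(2)[OF x]] by blast
    show "frechet_derivative (P j) (at x) (axis i 1) = frechet_derivative (P i) (at x) (axis j 1)" for i j
    proof -
      let ?DDX = "\<lambda>j. frechet_derivative (\<lambda>z. DX z (axis j 1)) (at x)"
      have P': "frechet_derivative (P j) (at x) = (\<lambda>v. of_real sc_const *
         (DX x (axis j 1) * - (inverse (Y x) * DY x v * inverse (Y x)) + ?DDX j v * inverse (Y x)))" for j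
      proof -
        have "((\<lambda>z. of_real sc_const * (DX z (axis j 1) * inverse (Y z))) has_derivative (\<lambda>v. of_real sc_const *
         (DX x (axis j 1) * - (inverse (Y x) * DY x v * inverse (Y x)) + ?DDX j v * inverse (Y x)))) (at x)"
          by (rule has_derivative_mult_right[OF has_derivative_mult[OF Ck_on_has_derivative[OF CkDX x]
               Deriv.has_derivative_inverse[of Y x, OF curve(2)[OF x] Y'[OF x]]]])
        then have "(P j has_derivative (\<lambda>v. of_real sc_const *
         (DX x (axis j 1) * - (inverse (Y x) * DY x v * inverse (Y x)) + ?DDX j v * inverse (Y x)))) (at x)"
          by (simp only: P_def [abs_def] mult.assoc)
        then show ?thesis by (rule frechet_derivative_at[symmetric])
      qed
      have "?DDX j (axis i 1) = ?DDX i (axis j 1)"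
        unfolding DX_def by (rule symmetric_second_derivative[OF V x Ck(1)])
      then show ?thesis by (simp add: P' c)
    qed
    show independent: "d l = 0" if sum0: "(\<Sum>l\<in>UNIV. d l *\<^sub>R P l x) = 0" for d l
    proof -
      have lin: "linear (DX x)"
        using X'[OF x] by (rule has_derivative_linear)
      let ?d = "\<Sum>l\<in>UNIV. d l *\<^sub>R axis l 1 :: real^2"
      have "(\<Sum>l\<in>UNIV. d l *\<^sub>R P l x) = of_real sc_const * DX x ?d * inverse (Y x)"
        by (simp add: P_def linear_sum[OF lin] linear_cmul[OF lin] sum_distrib_left sum_distrib_right)
      then have "DX x ?d = 0" using sum0 k curve(2)[OF x] by simp
      then have "frechet_derivative \<phi> (at x) ?d = frechet_derivative \<phi> (at x) 0"
        by (simp add: D\<phi>[OF x] c linear_0[OF lin])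
      then have "?d = 0" using inj[OF x] by (meson injD)
      then have "?d $ l = 0" by simp
      then show "d l = 0"
        by (simp add: axis_def if_distrib cong: if_cong)
    qed
    show "\<exists>c. w = (\<Sum>l\<in>UNIV. c l *\<^sub>R P l x)" for w
    proof (rule injective_linear_spanning[where w = "\<lambda>l. P l x"])
      show "d l = 0" if "(\<Sum>l\<in>UNIV. d l *\<^sub>R P l x) = 0" for d l
        using that by (rule independent)
    qed simp
    show "metric_coeffs Gamma_metric \<phi> x = (\<chi> i j. P i x \<bullet> P j x)"
      by (simp add: metric_coeffs_def Gamma_metric_def P_def inner_scaled_quotients D\<phi>[OF x] Y_def)
  qed
  then show ?thesis
    unfolding P_def [abs_def] DX_def X_def Y_def .
qed

lemma partial_deriv_const: "partial_deriv i (\<lambda>x. c) x = 0"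
  by (simp add: partial_deriv_def)

lemma riemann_curvature_Gamma:
  assumes "local_parametrization S_reg V \<phi>" "x \<in> V"
  shows "riemann_curvature (metric_coeffs Gamma_metric \<phi>) l i j k x = 0"
proof (cases "sc_const = 0")
  \<comment> \<open>The case distinction replaces an estimate of the integral in the constant: if the constant
    were zero, all metric coefficients would vanish, and with them the curvature.\<close>
  case True
  then have "metric_coeffs Gamma_metric \<phi> = (\<lambda>x. 0)"
    by (simp add: fun_eq_iff metric_coeffs_def Gamma_metric_def vec_eq_iff)
  moreover have "christoffel (\<lambda>x. 0) l i j = (\<lambda>x. 0)" for l i j :: 2
    by (simp add: fun_eq_iff christoffel_def partial_deriv_const)
  ultimately show ?thesis
    by (simp add: riemann_curvature_def partial_deriv_const)
next
  case False
  have "\<phi> ` V \<subseteq> S_reg"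
    using assms(1) openin_imp_subset unfolding local_parametrization_def by blast
  then have "closed_coframe V
    (\<lambda>i x. of_real sc_const * frechet_derivative (\<lambda>y. fst (\<phi> y)) (at x) (axis i 1) * inverse (snd (\<phi> x)))
    (metric_coeffs Gamma_metric \<phi>)"
    using assms(1) False unfolding local_parametrization_def by (intro closed_coframe_Gamma) auto
  then show ?thesis
    using assms(2) by (rule closed_coframe.riemann_curvature_zero)
qed

section \<open>Charts of the curve\<close>

definition complex_of_vec :: "real^2 \<Rightarrow> complex" where
  "complex_of_vec x = Complex (x $ 1) (x $ 2)"

definition vec_of_complex :: "complex \<Rightarrow> real^2" where
  "vec_of_complex z = (\<chi> i. if i = 1 then Re z else Im z)"

lemma vec_of_complex_inverse: "complex_of_vec (vec_of_complex z) = z"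
  by (simp add: complex_of_vec_def vec_of_complex_def)

lemma complex_of_vec_inverse: "vec_of_complex (complex_of_vec x) = x"
  by (auto simp: complex_of_vec_def vec_of_complex_def vec_eq_iff forall_2)

lemma bounded_linear_complex_of_vec: "bounded_linear complex_of_vec"
  unfolding linear_conv_bounded_linear[symmetric]
  by (rule linearI) (simp_all add: complex_of_vec_def complex_eq_iff)

lemma bounded_linear_vec_of_complex: "bounded_linear vec_of_complex"
  unfolding linear_conv_bounded_linear[symmetric]
  by (rule linearI) (simp_all add: vec_of_complex_def vec_eq_iff)

text \<open>Projection to the first coordinate is a continuous left inverse of a graph parametrization,
  and its differential is a left inverse of the differential.\<close>

lemma local_parametrization_graph:
  fixes M :: "(complex \<times> complex) set"
  assumes U: "open U" and g: "g holomorphic_on U"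
    and graph: "openin (top_of_set M) ((\<lambda>\<xi>. (\<xi>, g \<xi>)) ` U)"
  shows "local_parametrization M (complex_of_vec -` U) (\<lambda>x. (complex_of_vec x, g (complex_of_vec x)))"
    (is "local_parametrization M ?V ?\<phi>")
  unfolding local_parametrization_def
proof (intro conjI ballI)
  note lin = bounded_linear_complex_of_vec
  show V: "open ?V"
    using U lin by (intro open_vimage linear_continuous_on)
  have "surj complex_of_vec"
    by (rule surjI[where f = vec_of_complex]) (rule vec_of_complex_inverse)
  then have "complex_of_vec ` ?V = U"
    by (rule surj_image_vimage_eq)
  moreover have "?\<phi> ` ?V = (\<lambda>\<xi>. (\<xi>, g \<xi>)) ` (complex_of_vec ` ?V)"
    by (simp only: image_image)
  ultimately have img: "?\<phi> ` ?V = (\<lambda>\<xi>. (\<xi>, g \<xi>)) ` U" by simp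
  then show "openin (top_of_set M) (?\<phi> ` ?V)" using graph by simp
  have Ck: "Ck_on n ?\<phi> ?V" for n
    using Ck_on_holomorphic_linear[OF lin U holomorphic_on_ident]
      Ck_on_holomorphic_linear[OF lin U g] by (intro Ck_on_Pair V)
  then show "smooth_on ?\<phi> ?V" by (simp add: smooth_on_def)
  show "inj (frechet_derivative ?\<phi> (at x))" if "x \<in> ?V" for x
  proof -
    have "((\<lambda>x. fst (?\<phi> x)) has_derivative (\<lambda>v. fst (frechet_derivative ?\<phi> (at x) v))) (at x)"
      by (rule has_derivative_fst[OF Ck_on_has_derivative[OF Ck that]])
    moreover have "((\<lambda>x. fst (?\<phi> x)) has_derivative complex_of_vec) (at x)"
      using bounded_linear_imp_has_derivative[OF lin] by simp
    ultimately have "(\<lambda>v. fst (frechet_derivative ?\<phi> (at x) v)) = complex_of_vec"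
      by (rule has_derivative_unique)
    moreover have "inj complex_of_vec"
      by (rule inj_on_inverseI[where g = vec_of_complex]) (rule complex_of_vec_inverse)
    ultimately have "inj (fst \<circ> frechet_derivative ?\<phi> (at x))" by (simp only: comp_def)
    then show ?thesis by (rule inj_on_imageI2)
  qed
  show "\<exists>\<psi>. homeomorphism ?V (?\<phi> ` ?V) ?\<phi> \<psi>"
  proof (intro exI homeomorphismI)
    show "continuous_on ?V ?\<phi>" using Ck[of 0] by simp
    show "continuous_on (?\<phi> ` ?V) (\<lambda>p. vec_of_complex (fst p))"
      by (intro continuous_on_compose2[OF linear_continuous_on[OF bounded_linear_vec_of_complex]]
          continuous_intros) auto
  qed (auto simp: complex_of_vec_inverse)
qed

text \<open>The branch \<open>g\<close> of the tenth root is normalized to have the value \<open>\<eta>0\<close> at \<open>\<xi>0\<close>. Over its domain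
  a point of the curve has \<open>\<eta> = \<zeta> g(\<xi>)\<close> with a tenth root of unity \<open>\<zeta>\<close>. There are finitely many of
  these, so excluding all values of \<open>\<eta>/g(\<xi>)\<close> among them except \<open>1\<close> is an open condition that
  isolates the graph of \<open>g\<close> within the curve.\<close>

lemma S_reg_chart_exists:
  assumes p: "p \<in> S_reg"
  obtains V \<phi> where "local_parametrization S_reg V \<phi>" "p \<in> \<phi> ` V"
proof -
  obtain \<xi>0 \<eta>0 where p_eq: "p = (\<xi>0, \<eta>0)" by fastforce
  have \<eta>0: "\<eta>0 ^ 10 = f_poly \<xi>0" "\<eta>0 \<noteq> 0" using p by (auto simp: p_eq S_reg_iff)
  then have f0: "f_poly \<xi>0 \<noteq> 0" by (metis power_not_zero)
  define q where "q \<xi> = f_poly \<xi> / f_poly \<xi>0" for \<xi>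
  define U where "U = q -` (- \<real>\<^sub>\<le>\<^sub>0)"
  define g where "g \<xi> = \<eta>0 * exp (Ln (q \<xi>) / 10)" for \<xi>
  have q: "q holomorphic_on A" for A
    unfolding q_def using f0 by (intro holomorphic_intros holomorphic_f_poly)
  have U: "open U"
    unfolding U_def
    by (intro open_vimage holomorphic_on_imp_continuous_on q) (simp add: open_Compl)
  have g: "g holomorphic_on U"
    unfolding g_def by (intro holomorphic_intros q) (auto simp: U_def)
  have g_nz: "g \<xi> \<noteq> 0" for \<xi> using \<eta>0 by (simp add: g_def)
  have g10: "g \<xi> ^ 10 = f_poly \<xi>" if "\<xi> \<in> U" for \<xi>
  proof -
    have "q \<xi> \<noteq> 0" using that by (auto simp: U_def)
    moreover have "exp (Ln (q \<xi>) / 10) ^ 10 = exp (Ln (q \<xi>))"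
      by (simp flip: exp_of_nat_mult)
    ultimately show ?thesis
      using f0 by (simp add: g_def power_mult_distrib \<eta>0 q_def)
  qed
  define R where "R = {z::complex. z ^ 10 = 1 \<and> z \<noteq> 1}"
  define W where "W = (U \<times> UNIV) \<inter> (\<lambda>p. snd p / g (fst p)) -` (- R)"
  have "finite R"
    by (rule finite_subset[OF _ finite_roots_unity[of 10]]) (auto simp: R_def)
  have "open W"
    unfolding W_def
  proof (rule continuous_open_preimage)
    show "continuous_on (U \<times> UNIV) (\<lambda>p. snd p / g (fst p))"
      using g_nz by (intro continuous_intros
          continuous_on_compose2[OF holomorphic_on_imp_continuous_on[OF g]]) auto
    show "open (U \<times> UNIV)" using U by (simp add: open_Times)
    show "open (- R)" using \<open>finite R\<close> by (simp add: finite_imp_closed open_Compl)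
  qed
  have "(\<lambda>\<xi>. (\<xi>, g \<xi>)) ` U = S_reg \<inter> W"
  proof (intro equalityI subsetI)
    fix z assume "z \<in> (\<lambda>\<xi>. (\<xi>, g \<xi>)) ` U"
    then show "z \<in> S_reg \<inter> W"
      using g10 g_nz by (auto simp: S_reg_iff W_def R_def)
  next
    fix z assume z: "z \<in> S_reg \<inter> W"
    then have zU: "fst z \<in> U" by (auto simp: W_def)
    have "(snd z / g (fst z)) ^ 10 = 1"
      using z g10[OF zU] g_nz[of "fst z"] by (auto simp: S_reg_iff power_divide)
    then have "snd z / g (fst z) = 1" using z by (auto simp: W_def R_def)
    then have "snd z = g (fst z)" using g_nz by simp
    then show "z \<in> (\<lambda>\<xi>. (\<xi>, g \<xi>)) ` U" 
      using zU by (intro image_eqI[where x = "fst z"]) (simp_all add: prod_eq_iff)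
  qed
  then have "openin (top_of_set S_reg) ((\<lambda>\<xi>. (\<xi>, g \<xi>)) ` U)"
    using \<open>open W\<close> by (simp add: openin_open_Int)
  then have chart: "local_parametrization S_reg (complex_of_vec -` U)
      (\<lambda>x. (complex_of_vec x, g (complex_of_vec x)))"
    by (rule local_parametrization_graph[OF U g])
  have "q \<xi>0 = 1" using f0 by (simp add: q_def)
  then have "\<xi>0 \<in> U" "g \<xi>0 = \<eta>0" by (simp_all add: U_def g_def)
  then have "p \<in> (\<lambda>x. (complex_of_vec x, g (complex_of_vec x))) ` (complex_of_vec -` U)"
    by (intro image_eqI[where x = "vec_of_complex \<xi>0"]) (simp_all add: p_eq vec_of_complex_inverse)
  with chart show ?thesis by (rule that)
qed

theorem corollary3: "flat_metric_on S_reg Gamma_metric"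
  unfolding flat_metric_on_def
proof (intro conjI ballI allI impI)
  show "\<exists>V \<phi>. local_parametrization S_reg V \<phi> \<and> p \<in> \<phi> ` V" if "p \<in> S_reg" for p
    by (rule S_reg_chart_exists[OF that]) blast
qed (rule riemann_curvature_Gamma)

end
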